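(* Let $\gamma\colon[a,b]\to\mathbb{R}^2$ be a simple smooth plane loop whose absolute curvature is at most $1$ at every point. Then $\gamma$ surrounds a unit disc; that is, the closed bounded region of the plane bounded by $\gamma$ contains a disc of radius $1$.
   Context: A smooth plane loop is a map $\gamma\colon[a,b]\to\mathbb{R}^2$ that is $C^\infty$ on the closed interval, regular ($\gamma'(t)\neq 0$ for all $t\in[a,b]$), and satisfies $\gamma(a)=\gamma(b)$; this common point is called the base of the loop. The loop need not be smooth at its base, that is, the directions of $\gamma'(a)$ and $\gamma'(b)$ may differ. The loop is simple if $\gamma(s)\neq\gamma(t)$ for $s\ne t$ unless $\{s,t\}=\{a,b\}$. By Jordan's theorem a simple loop bounds a closed bounded region (the bounded component of the complement together with the image of $\gamma$). The absolute curvature of $\gamma$ at a parameter value is the magnitude of its acceleration when $\gamma$ is parametrized by arc length. *)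

theory Defs
  imports "HOL-Analysis.Analysis"
begin

(* All derivatives are taken within the parameter interval, hence are one-sided at its
   endpoints: smoothness is required up to the endpoints, but nothing relates the
   derivatives at a to those at b. *)

definition smooth_on_interval :: "real \<Rightarrow> real \<Rightarrow> (real \<Rightarrow> 'a::real_normed_vector) \<Rightarrow> bool" where
  "smooth_on_interval a b f \<longleftrightarrow>
     (\<exists>D :: nat \<Rightarrow> real \<Rightarrow> 'a. D 0 = f \<and>
        (\<forall>n. \<forall>t\<in>{a..b}. (D n has_vector_derivative D (Suc n) t) (at t within {a..b})))"

definition velocity :: "real \<Rightarrow> real \<Rightarrow> (real \<Rightarrow> 'a::real_normed_vector) \<Rightarrow> real \<Rightarrow> 'a" where
  "velocity a b f t = vector_derivative f (at t within {a..b})"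

definition smooth_plane_loop :: "real \<Rightarrow> real \<Rightarrow> (real \<Rightarrow> real^2) \<Rightarrow> bool" where
  "smooth_plane_loop a b \<gamma> \<longleftrightarrow>
     a < b \<and> smooth_on_interval a b \<gamma> \<and> (\<forall>t\<in>{a..b}. velocity a b \<gamma> t \<noteq> 0) \<and> \<gamma> a = \<gamma> b"

definition simple_loop :: "real \<Rightarrow> real \<Rightarrow> (real \<Rightarrow> real^2) \<Rightarrow> bool" where
  "simple_loop a b \<gamma> \<longleftrightarrow>
     (\<forall>s\<in>{a..b}. \<forall>t\<in>{a..b}. s \<noteq> t \<longrightarrow> \<gamma> s = \<gamma> t \<longrightarrow> {s, t} = {a, b})"

definition arc_length :: "real \<Rightarrow> real \<Rightarrow> (real \<Rightarrow> real^2) \<Rightarrow> real \<Rightarrow> real" where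
  "arc_length a b \<gamma> t = integral {a..t} (\<lambda>u. norm (velocity a b \<gamma> u))"

(* For a smooth regular curve, arc_length a b \<gamma> is a strictly increasing bijection from
   {a..b} onto {0..arc_length a b \<gamma> b}; the following is meaningful on the latter interval. *)
definition arc_length_param :: "real \<Rightarrow> real \<Rightarrow> (real \<Rightarrow> real^2) \<Rightarrow> real \<Rightarrow> real^2" where
  "arc_length_param a b \<gamma> = \<gamma> \<circ> the_inv_into {a..b} (arc_length a b \<gamma>)"

definition abs_curvature :: "real \<Rightarrow> real \<Rightarrow> (real \<Rightarrow> real^2) \<Rightarrow> real \<Rightarrow> real" where
  "abs_curvature a b \<gamma> t =
     (let L = arc_length a b \<gamma> b
      in norm (velocity 0 L (velocity 0 L (arc_length_param a b \<gamma>)) (arc_length a b \<gamma> t)))"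

(* For a simple loop the complement of the image has exactly one bounded component (Jordan),
   and inside is that component. *)
definition bounded_region :: "real \<Rightarrow> real \<Rightarrow> (real \<Rightarrow> real^2) \<Rightarrow> (real^2) set" where
  "bounded_region a b \<gamma> = inside (\<gamma> ` {a..b}) \<union> \<gamma> ` {a..b}"

end

(* Parametrize the loop by arc length and suppose that every disc inside it has radius less than
   some \<rho> < 1.  Consider discs inside the loop that touch it at two parameters s < t; these
   parameters stay apart, since an arc of curvature at most 1 stays locally outside a tangent circle
   of radius less than 1.  By compactness t - s is minimal for some such disc.  Take a parameter m
   strictly between s and t at which some interior disc touches the loop, and enlarge this disc,
   keeping it tangent at m, until it touches the loop again.  The polygonal crosscut through the
   centre of the first disc separates the arc over [s, t] from its complement, and the radii of the
   second disc can cross it only if both discs coincide, so the second disc has two touching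
   parameters in [s, t].  This contradicts minimality.  The base point is harmless because
   tangency is used only at m, which is interior. *)
theory Submission
  imports Defs
begin

section \<open>Insides of sets\<close>

lemma connected_subset_inside:
  assumes "connected T" "T \<inter> S = {}" "x \<in> T" "x \<in> inside S"
  shows "T \<subseteq> inside S"
proof
  fix y assume "y \<in> T"
  then have "connected_component (- S) x y"
    unfolding connected_component_def using assms by blast
  then show "y \<in> inside S"
    using assms(4) inside_same_component by blast
qed

text \<open>A linear isomorphism carries the complementary component of \<open>g x\<close> into that
  of \<open>x\<close>. The latter is bounded, and pulling back by \<open>g\<close> preserves
  boundedness. This serves to move the result between two models of the plane.\<close>

lemma inside_linear_image_subset:
  fixes f :: "'a::euclidean_space \<Rightarrow> 'b::euclidean_space" and g :: "'b \<Rightarrow> 'a"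
  assumes f: "linear f" and g: "linear g" and fg: "\<And>y. f (g y) = y" and gf: "\<And>x. g (f x) = x"
    and x: "x \<in> inside (f ` S)"
  shows "g x \<in> inside S"
proof -
  let ?C = "connected_component_set (- S) (g x)"
  have xn: "x \<notin> f ` S" and bd: "bounded (connected_component_set (- f ` S) x)"
    using x by (auto simp: inside_def)
  then have gxn: "g x \<notin> S" by (metis fg image_eqI)
  have "f ` ?C \<subseteq> connected_component_set (- f ` S) x"
  proof (rule connected_component_maximal)
    have "g x \<in> ?C" using gxn by simp
    then show "x \<in> f ` ?C" by (metis fg image_eqI)
    show "connected (f ` ?C)"
      by (intro connected_continuous_image linear_continuous_on connected_connected_component
          linear_conv_bounded_linear[THEN iffD1] f)
    have "?C \<subseteq> - S" by (rule connected_component_subset)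
    then show "f ` ?C \<subseteq> - f ` S"
      using inj_on_inverseI[of UNIV g f] gf by (metis Compl_iff image_mono inj_image_Compl_subset order_trans)
  qed
  then have "bounded (f ` ?C)"
    using bd bounded_subset by blast
  then have "bounded (g ` f ` ?C)"
    by (rule bounded_linear_image) (rule linear_conv_bounded_linear[THEN iffD1, OF g])
  then have "bounded ?C" by (simp add: image_image gf)
  then show ?thesis using gxn by (simp add: inside_def)
qed

section \<open>Nearest points and the segments leading to them\<close>

text \<open>For \<open>q\<close> inside a loop with image \<open>S\<close>, this expresses that the
  disc about \<open>q\<close> of radius \<open>infdist q S\<close> touches the loop at
  \<open>z\<close>. Since \<open>infdist\<close> is continuous in \<open>q\<close>, touching is a
  closed condition, as the compactness argument requires.\<close>

definition nearest_point :: "'a::metric_space set \<Rightarrow> 'a \<Rightarrow> 'a \<Rightarrow> bool"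
  where "nearest_point S q z \<longleftrightarrow> z \<in> S \<and> dist q z = infdist q S"

lemma nearest_pointI:
  assumes "z \<in> S" "\<And>w. w \<in> S \<Longrightarrow> dist q z \<le> dist q w"
  shows "nearest_point S q z"
proof -
  have "dist q z \<le> infdist q S"
    using assms unfolding infdist_def by (auto intro: cINF_greatest)
  then show ?thesis
    using assms(1) infdist_le[OF assms(1), of q] by (simp add: nearest_point_def)
qed

lemma nearest_pointD:
  assumes "nearest_point S q z" "w \<in> S"
  shows "dist q z \<le> dist q w"
  using assms infdist_le by (fastforce simp: nearest_point_def)

text \<open>Distances add along the segment, so a point of \<open>S\<close> closer to
  \<open>x\<close> would also be closer to \<open>q\<close>.\<close>

lemma nearest_point_segment:
  fixes q :: "'a::euclidean_space"
  assumes "nearest_point S q z" "x \<in> closed_segment q z"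
  shows "nearest_point S x z"
proof (rule nearest_pointI)
  show "z \<in> S" using assms(1) by (simp add: nearest_point_def)
  fix w assume "w \<in> S"
  then have "dist q z \<le> dist q w" using assms(1) nearest_pointD by blast
  moreover have "dist q z = dist q x + dist x z"
    using assms(2) by (metis between between_mem_segment)
  ultimately show "dist x z \<le> dist x w"
    using dist_triangle[of q w x] by simp
qed

text \<open>The broken line from \<open>q\<close> through \<open>x\<close> to \<open>w\<close> is no
  longer than the minimal distance \<open>dist q z\<close>, hence it is straight. Thus
  \<open>w\<close> and \<open>z\<close> lie on the same ray from \<open>q\<close>, at the same
  distance.\<close>

lemma nearest_point_segment_unique:
  fixes q :: "'a::euclidean_space"
  assumes z: "nearest_point S q z" and x: "x \<in> closed_segment q z" "x \<noteq> q"
    and w: "nearest_point S x w"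
  shows "w = z"
proof -
  have eq: "dist x w = dist x z"
    using nearest_point_segment[OF z x(1)] w by (simp add: nearest_point_def)
  have sum: "dist q z = dist q x + dist x z"
    using x(1) by (metis between between_mem_segment)
  have "w \<in> S" using w by (simp add: nearest_point_def)
  then have "dist q z \<le> dist q w" using z nearest_pointD by blast
  then have "dist q w = dist q x + dist x w"
    using dist_triangle[of q w x] sum eq by simp
  then have "x \<in> closed_segment q w" by (metis between between_mem_segment)
  then obtain l where l: "0 \<le> l" "x - q = l *\<^sub>R (w - q)"
    by (auto simp: in_segment algebra_simps)
  obtain k where k: "0 \<le> k" "x - q = k *\<^sub>R (z - q)"
    using x(1) by (auto simp: in_segment algebra_simps)
  have "norm (w - q) = norm (z - q)"
    using \<open>dist q w = dist q x + dist x w\<close> sum eq by (simp add: dist_norm norm_minus_commute)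
  moreover have "norm (z - q) \<noteq> 0" "k \<noteq> 0" using k x(2) by auto
  moreover have "l * norm (w - q) = k * norm (z - q)"
    using l k by (metis abs_of_nonneg norm_scaleR)
  ultimately have "l = k" by simp
  then have "k *\<^sub>R (w - q) = k *\<^sub>R (z - q)" using l k by metis
  then show ?thesis using \<open>k \<noteq> 0\<close> by simp
qed

text \<open>Both \<open>z\<close> and \<open>z'\<close> are nearest to the crossing point, while
  away from the centre of either segment the nearest point is unique.\<close>

lemma nearest_segments_cross:
  fixes q :: "'a::euclidean_space"
  assumes z: "nearest_point S q z" and x: "x \<in> closed_segment q z"
    and z': "nearest_point S q' z'" and x': "x \<in> closed_segment q' z'"
    and ne: "z \<noteq> z'"
  shows "x = q" "x = q'"
  using nearest_point_segment_unique[OF z x] nearest_point_segment_unique[OF z' x']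
    nearest_point_segment[OF z x] nearest_point_segment[OF z' x'] ne by auto

section \<open>Crosscuts of Jordan domains and discs inside a curve\<close>

text \<open>The crosscut \<open>c\<close> divides the Jordan domain into the insides of two curves,
  \<open>c1\<close> with \<open>c\<close> and \<open>c2\<close> with \<open>c\<close>. A connected
  set that avoids \<open>c\<close> stays in one of them, so its closure cannot reach the open
  boundary arcs on both sides.\<close>

lemma crosscuts_meet:
  fixes c :: "real \<Rightarrow> complex"
  assumes sp: "simple_path c1" "simple_path c2" "simple_path c"
    and ends: "pathstart c1 = a" "pathfinish c1 = b" "pathstart c2 = a" "pathfinish c2 = b"
      "pathstart c = a" "pathfinish c = b" "a \<noteq> b"
    and c1c2: "path_image c1 \<inter> path_image c2 = {a,b}"
    and c_in: "path_image c - {a,b} \<subseteq> inside (path_image c1 \<union> path_image c2)"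
    and D: "connected D" "D \<subseteq> inside (path_image c1 \<union> path_image c2)"
    and P: "P \<in> closure D" "P \<in> path_image c1" "P \<notin> {a,b}"
    and Q: "Q \<in> closure D" "Q \<in> path_image c2" "Q \<notin> {a,b}"
  shows "D \<inter> path_image c \<noteq> {}"
proof
  assume disj: "D \<inter> path_image c = {}"
  let ?I = "inside (path_image c1 \<union> path_image c2)"
  let ?I1 = "inside (path_image c1 \<union> path_image c)"
  let ?I2 = "inside (path_image c2 \<union> path_image c)"
  have nov: "?I \<inter> (path_image c1 \<union> path_image c2) = {}" by simp
  have ab: "a \<in> path_image c" "b \<in> path_image c"
    using ends pathstart_in_path_image pathfinish_in_path_image by metis+
  have ab2: "a \<in> path_image c1" "b \<in> path_image c1" "a \<in> path_image c2" "b \<in> path_image c2"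
    using c1c2 by blast+
  have c1c: "path_image c1 \<inter> path_image c = {a,b}" "path_image c2 \<inter> path_image c = {a,b}"
    using c_in nov ab ab2 by blast+
  \<comment> \<open>The splitting theorem asks that \<open>c\<close> meet the inside. Its image is
    connected and therefore more than two distinct points.\<close>
  have "path_image c \<noteq> {a,b}"
    using connected_simple_path_image[OF sp(3)] \<open>a \<noteq> b\<close>
    by (metis connected_finite_iff_sing doubleton_eq_iff finite.emptyI finite.insertI insert_absorb2 insert_not_empty singleton_insert_inj_eq)
  then have ne: "path_image c \<inter> ?I \<noteq> {}"
    using c_in ab by blast
  obtain dj: "?I1 \<inter> ?I2 = {}" and un: "?I1 \<union> ?I2 \<union> (path_image c - {a,b}) = ?I"
    using split_inside_simple_closed_curve[OF sp(1) ends(1,2) sp(2) ends(3,4) sp(3) ends(5-7) c1c2 c1c ne]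
    by blast
  have cl: "closed (path_image c1 \<union> path_image c)" "closed (path_image c2 \<union> path_image c)"
    using sp by (simp_all add: closed_simple_path_image closed_Un)
  have op: "open ?I1" "open ?I2" using cl open_inside by blast+
  have "D \<subseteq> ?I1 \<union> ?I2" using D(2) un disj by blast
  then consider "D \<subseteq> ?I1" | "D \<subseteq> ?I2"
    using connectedD[OF D(1) op] dj by blast
  then show False
  proof cases
    case 1
    then have "Q \<in> path_image c1 \<union> path_image c \<union> ?I1"
      using closure_inside_subset[OF cl(1)] closure_mono[OF 1] Q(1) by blast
    then show False using Q c1c c1c2 un nov by blast
  next
    case 2
    then have "P \<in> path_image c2 \<union> path_image c \<union> ?I2"
      using closure_inside_subset[OF cl(2)] closure_mono[OF 2] P(1) by blast
    then show False using P c1c c1c2 un nov by blast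
  qed
qed

text \<open>The open ball is connected, contains \<open>q\<close>, and misses \<open>S\<close>
  because no point of \<open>S\<close> is closer to \<open>q\<close> than \<open>z\<close>.\<close>

lemma ball_nearest_point_inside:
  fixes q :: "'a::real_normed_vector"
  assumes "nearest_point S q z" "q \<in> inside S"
  shows "ball q (dist q z) \<subseteq> inside S"
proof (rule connected_subset_inside)
  show "ball q (dist q z) \<inter> S = {}"
    using nearest_pointD[OF assms(1)] by fastforce
  have "q \<noteq> z" using assms inside_no_overlap[of S] unfolding nearest_point_def by blast
  then show "q \<in> ball q (dist q z)" by simp
qed (use assms in auto)

lemma closed_segment_nearest_in_ball:
  fixes q :: "'a::euclidean_space"
  assumes "x \<in> closed_segment q z" "x \<noteq> z"
  shows "x \<in> ball q (dist q z)"
proof -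
  have "dist q z = dist q x + dist x z"
    using assms(1) by (metis between between_mem_segment)
  then show ?thesis using assms(2) by simp
qed

lemma endpoint_in_closure_ball_segment:
  fixes q :: "'a::euclidean_space"
  assumes "q \<noteq> z"
  shows "z \<in> closure (closed_segment q z \<inter> ball q (dist q z))"
proof -
  have "open_segment q z \<subseteq> closed_segment q z \<inter> ball q (dist q z)"
    using closed_segment_nearest_in_ball by (fastforce simp: open_segment_def)
  then have "closure (open_segment q z) \<subseteq> closure (closed_segment q z \<inter> ball q (dist q z))"
    by (rule closure_mono)
  then show ?thesis using assms by (simp add: closure_open_segment subset_iff)
qed

section \<open>Simple closed curves in the plane\<close>

text \<open>The plane is modelled by \<open>complex\<close>, the type for which the Jordan curve
  theorem and the splitting theorem are stated.\<close>

locale plane_loop =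
  fixes L :: real and c :: "real \<Rightarrow> complex"
  assumes L: "0 < L"
    and cont: "continuous_on {0..L} c"
    and closes: "c 0 = c L"
    and simple: "\<lbrakk>x \<in> {0..L}; y \<in> {0..L}; x < y; c x = c y\<rbrakk> \<Longrightarrow> x = 0 \<and> y = L"
begin

abbreviation trace where "trace \<equiv> c ` {0..L}"

definition loop_path where "loop_path x = c (L * x)"

lemma interior_param_unique:
  assumes "x \<in> {0..L}" "0 < m" "m < L" "c x = c m"
  shows "x = m"
  using simple[of x m] simple[of m x] assms by (cases x m rule: linorder_cases) auto

lemma scale_image: "(*) L ` {0..1} = {0..L}"
  using L by (simp add: image_mult_atLeastAtMost)

lemma path_image_loop_path: "path_image loop_path = trace"
  unfolding path_image_def loop_path_def using scale_image by (metis image_image)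

lemma closed_loop_path: "pathfinish loop_path = pathstart loop_path"
  using closes by (simp add: pathfinish_def pathstart_def loop_path_def)

lemma simple_path_loop_path: "simple_path loop_path"
proof -
  have "continuous_on {0..1} loop_path"
    unfolding loop_path_def using cont scale_image
    by (intro continuous_on_compose2[OF cont]) (auto intro!: continuous_intros)
  moreover have "loop_free loop_path"
    unfolding loop_free_def
  proof (intro ballI impI)
    fix x y :: real assume xy: "x \<in> {0..1}" "y \<in> {0..1}" "loop_path x = loop_path y"
    then have "L * x \<in> {0..L}" "L * y \<in> {0..L}" "c (L * x) = c (L * y)"
      using L by (auto simp: loop_path_def)
    then have "L * x = L * y \<or> L * x = 0 \<and> L * y = L \<or> L * y = 0 \<and> L * x = L"
      using simple[of "L * x" "L * y"] simple[of "L * y" "L * x"] by argo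
    then show "x = y \<or> x = 0 \<and> y = 1 \<or> x = 1 \<and> y = 0" using L by auto
  qed
  ultimately show ?thesis by (simp add: simple_path_def path_def)
qed

lemma compact_trace: "compact trace"
  using cont compact_continuous_image compact_Icc by blast

lemma closed_trace: "closed trace"
  using compact_trace compact_imp_closed by blast

lemma inside_trace:
  shows "inside trace \<noteq> {}" "open (inside trace)" "bounded (inside trace)"
    "frontier (inside trace) = trace"
  using Jordan_inside_outside[OF simple_path_loop_path closed_loop_path] by (simp_all add: path_image_loop_path)

lemma closure_inside_trace: "closure (inside trace) = inside trace \<union> trace"
  using inside_trace closure_Un_frontier by metis

text \<open>
  Two touching discs at interlaced points of the loop give two crosscuts that have to cross; as
  interior points of a segment from a centre to a nearest point have only that nearest point,
  they can cross at the centres only.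
\<close>
lemma double_touch_eq:
  assumes st: "0 \<le> s" "s < m" "m < t" "t \<le> L" and ne: "c s \<noteq> c t"
    and q: "q \<in> inside trace" "nearest_point trace q (c s)" "nearest_point trace q (c t)"
    and q': "q' \<in> inside trace" "nearest_point trace q' (c m)" "nearest_point trace q' z"
    and z: "z \<notin> c ` {s..t}"
  shows "q = q'"
proof -
  \<comment> \<open>Starting the loop at parameter \<open>s\<close> makes the arc over
    \<open>{s..t}\<close> an initial piece \<open>{0..\<tau>}\<close> and the rest, which passes
    through the base, a single final piece \<open>{\<tau>..1}\<close>.\<close>
  define h where "h = shiftpath (s / L) loop_path"
  define \<tau> where "\<tau> = (t - s) / L"
  have sL: "0 \<le> s / L" "s / L \<le> 1" using st L by auto
  have tau: "0 < \<tau>" "\<tau> \<le> 1" using st L by (auto simp: \<tau>_def)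
  have sh: "simple_path h"
    unfolding h_def by (rule simple_path_shiftpath[OF simple_path_loop_path closed_loop_path sL])
  have pih: "path_image h = trace"
    unfolding h_def using path_image_shiftpath[of "s / L" loop_path] sL closed_loop_path path_image_loop_path by simp
  have hval: "h x = c (s + L * x)" if "x \<le> \<tau>" for x
  proof -
    have "L * x \<le> L * \<tau>" using that L by (intro mult_left_mono) auto
    then have "L * x \<le> L - s" using st L by (simp add: \<tau>_def)
    then have "s / L + x \<le> 1" using L by (simp add: field_simps)
    moreover have "L * (s / L + x) = s + L * x" using L by (simp add: distrib_left)
    ultimately show ?thesis by (simp add: h_def shiftpath_def loop_path_def)
  qed
  have h0: "h 0 = c s" using hval[of 0] tau by simp
  have ht: "h \<tau> = c t" using hval[of \<tau>] L by (simp add: \<tau>_def)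
  have h1: "h 1 = c s"
    using closed_shiftpath[OF closed_loop_path, of "s / L"] sL h0
    by (simp add: h_def pathstart_def pathfinish_def)
  have tau1: "\<tau> < 1" using tau ht h1 ne by (cases "\<tau> = 1") auto
  define c1 where "c1 = subpath 0 \<tau> h"
  \<comment> \<open>Run backwards from 1, so that both arcs lead from \<open>c s\<close> to
    \<open>c t\<close>.\<close>
  define c2 where "c2 = subpath 1 \<tau> h"
  have sp: "simple_path c1" "simple_path c2"
    unfolding c1_def c2_def using sh tau tau1 by (auto intro!: simple_path_subpath)
  have pi1: "path_image c1 = h ` {0..\<tau>}" and pi2: "path_image c2 = h ` {\<tau>..1}"
    using tau by (simp_all add: c1_def c2_def path_image_subpath)
  have un: "path_image c1 \<union> path_image c2 = trace"
  proof -
    have "{0..\<tau>} \<union> {\<tau>..1} = {0..1}" using tau by auto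
    then show ?thesis unfolding pi1 pi2 using pih
      by (simp add: image_Un[symmetric] path_image_def)
  qed
  have arc1: "path_image c1 = c ` {s..t}"
  proof -
    have "path_image c1 = (\<lambda>x. c (s + L * x)) ` {0..\<tau>}"
      unfolding pi1 using hval by (intro image_cong) auto
    also have "\<dots> = c ` (\<lambda>x. L * x + s) ` {0..\<tau>}" by (simp add: image_image add.commute)
    also have "(\<lambda>x. L * x + s) ` {0..\<tau>} = {s..t}"
      using L tau by (simp add: image_affinity_atLeastAtMost \<tau>_def)
    finally show ?thesis .
  qed
  have int: "path_image c1 \<inter> path_image c2 = {c s, c t}"
  proof
    show "{c s, c t} \<subseteq> path_image c1 \<inter> path_image c2"
      unfolding pi1 pi2 using h0 h1 ht tau
      by (auto intro: image_eqI[of _ _ 0] image_eqI[of _ _ 1] image_eqI[of _ _ \<tau>])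
    show "path_image c1 \<inter> path_image c2 \<subseteq> {c s, c t}"
    proof
      fix w assume "w \<in> path_image c1 \<inter> path_image c2"
      then obtain x y where xy: "w = h x" "w = h y" "x \<in> {0..\<tau>}" "y \<in> {\<tau>..1}"
        unfolding pi1 pi2 by blast
      then have "x \<in> {0..1}" "y \<in> {0..1}" "h x = h y" using tau by auto
      then have "x = y \<or> x = 0 \<and> y = 1 \<or> x = 1 \<and> y = 0"
        using sh unfolding simple_path_def loop_free_def by blast
      then show "w \<in> {c s, c t}" using xy h0 h1 ht tau1 by auto
    qed
  qed
  let ?\<Theta> = "linepath (c s) q +++ linepath q (c t)"
  have onT: "c s \<in> trace" "c t \<in> trace" "c m \<in> trace" "z \<in> trace"
    using q q' by (auto simp: nearest_point_def)
  have "q \<notin> trace" "q' \<notin> trace"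
    using q(1) q'(1) inside_no_overlap[of trace] by blast+
  then have off: "c s \<noteq> q" "c t \<noteq> q" "c m \<noteq> q'" "z \<noteq> q'"
    using onT by metis+
  have pth: "path_image ?\<Theta> = closed_segment q (c s) \<union> closed_segment q (c t)"
    by (simp add: path_image_join closed_segment_commute)
  \<comment> \<open>Segments from \<open>q\<close> to two different nearest points share only
    \<open>q\<close>, so the polygonal crosscut is an arc.\<close>
  have "closed_segment q (c s) \<inter> closed_segment q (c t) \<subseteq> {q}"
    using nearest_segments_cross[OF q(2) _ q(3) _ ne] by auto
  then have "simple_path ?\<Theta>"
    using off by (intro arc_imp_simple_path arc_join) (auto simp: closed_segment_commute)
  have seg_in: "closed_segment p w - {w} \<subseteq> inside trace"
    if "p \<in> inside trace" "nearest_point trace p w" for p w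
    using ball_nearest_point_inside[OF that(2,1)] closed_segment_nearest_in_ball by blast
  \<comment> \<open>These are the two radii of the second disc. Intersecting with the balls removes
    the ends on the loop, so that \<open>D\<close> lies inside; the closure of \<open>D\<close>
    recovers those ends.\<close>
  define D where "D = closed_segment q' (c m) \<inter> ball q' (dist q' (c m))
      \<union> closed_segment q' z \<inter> ball q' (dist q' z)"
  have "connected D"
    unfolding D_def
  proof (rule connected_Un)
    have "q' \<in> closed_segment q' (c m) \<inter> ball q' (dist q' (c m)) \<inter> (closed_segment q' z \<inter> ball q' (dist q' z))"
      using off by simp
    then show "closed_segment q' (c m) \<inter> ball q' (dist q' (c m)) \<inter> (closed_segment q' z \<inter> ball q' (dist q' z)) \<noteq> {}"
      by blast
  qed (auto intro!: convex_connected convex_Int)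
  have clD: "c m \<in> closure D" "z \<in> closure D"
    using endpoint_in_closure_ball_segment[of q' "c m"] endpoint_in_closure_ball_segment[of q' z] off
    unfolding D_def closure_Un by auto
  have cm: "c m \<notin> {c s, c t}"
    using simple[of s m] simple[of m t] st by auto
  have cs: "c m \<in> c ` {s..t}" "c s \<in> c ` {s..t}" "c t \<in> c ` {s..t}" using st by auto
  have "D \<inter> path_image ?\<Theta> \<noteq> {}"
  proof (rule crosscuts_meet[where P = "c m" and Q = z, OF sp \<open>simple_path ?\<Theta>\<close> _ _ _ _ _ _ ne int _ \<open>connected D\<close>])
    show "path_image ?\<Theta> - {c s, c t} \<subseteq> inside (path_image c1 \<union> path_image c2)"
      unfolding pth un using seg_in[OF q(1,2)] seg_in[OF q(1,3)] by blast
    show "D \<subseteq> inside (path_image c1 \<union> path_image c2)"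
      unfolding D_def un using ball_nearest_point_inside[OF q'(2,1)] ball_nearest_point_inside[OF q'(3,1)]
      by blast
    show "z \<in> path_image c2" using onT un arc1 z by blast
    show "z \<notin> {c s, c t}" using z cs by auto
  qed (use clD cm arc1 cs in \<open>simp_all add: c1_def c2_def h0 h1 ht\<close>)
  then obtain x where "x \<in> D" "x \<in> path_image ?\<Theta>" by blast
  then obtain v w where vw: "v \<in> {c s, c t}" "x \<in> closed_segment q v"
      "w \<in> {c m, z}" "x \<in> closed_segment q' w"
    unfolding D_def pth by blast
  have "v \<noteq> w" using vw cm cs z by auto
  moreover have "nearest_point trace q v" "nearest_point trace q' w" using vw q q' by auto
  ultimately show ?thesis
    using nearest_segments_cross vw by metis
qed

end

section \<open>Unit speed curves of curvature at most 1 and their tangent circles\<close>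

text \<open>Derivatives are taken within \<open>{0..L}\<close> and are one-sided at its ends, which
  allows a corner at the base.\<close>

locale unit_speed_loop = plane_loop +
  fixes c' c'' :: "real \<Rightarrow> complex"
  assumes der: "x \<in> {0..L} \<Longrightarrow> (c has_vector_derivative c' x) (at x within {0..L})"
    and der2: "x \<in> {0..L} \<Longrightarrow> (c' has_vector_derivative c'' x) (at x within {0..L})"
    and unit: "x \<in> {0..L} \<Longrightarrow> norm (c' x) = 1"
    and curv: "x \<in> {0..L} \<Longrightarrow> norm (c'' x) \<le> 1"
begin

lemma dist_c_le:
  assumes "x \<in> {0..L}" "y \<in> {0..L}"
  shows "norm (c x - c y) \<le> \<bar>x - y\<bar>"
proof -
  have "norm (c x - c y) \<le> 1 * norm (x - y)"
    by (rule differentiable_bound[of "{0..L}" c "\<lambda>x h. h *\<^sub>R c' x"])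
      (use assms der unit in \<open>auto simp: has_vector_derivative_def intro!: onorm_le\<close>)
  then show ?thesis by simp
qed

lemma dist_sq_deriv:
  assumes "0 < x" "x < L"
  shows "((\<lambda>u. (c u - p) \<bullet> (c u - p)) has_real_derivative 2 * ((c x - p) \<bullet> c' x)) (at x)"
    and "((\<lambda>u. (c u - p) \<bullet> c' u) has_real_derivative (1 + (c x - p) \<bullet> c'' x)) (at x)"
proof -
  have d: "((\<lambda>u. c u - p) has_vector_derivative c' x) (at x)" "(c' has_vector_derivative c'' x) (at x)"
    using der[of x] der2[of x] assms by (auto simp: at_within_Icc_at intro: derivative_eq_intros)
  show "((\<lambda>u. (c u - p) \<bullet> (c u - p)) has_real_derivative 2 * ((c x - p) \<bullet> c' x)) (at x)"
    using bounded_bilinear.has_vector_derivative[OF bounded_bilinear_inner d(1) d(1)]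
    by (simp add: has_real_derivative_iff_has_vector_derivative inner_commute)
  have "c' x \<bullet> c' x = 1" using unit[of x] assms by (simp add: norm_eq_1)
  then show "((\<lambda>u. (c u - p) \<bullet> c' u) has_real_derivative (1 + (c x - p) \<bullet> c'' x)) (at x)"
    using bounded_bilinear.has_vector_derivative[OF bounded_bilinear_inner d]
    by (simp add: has_real_derivative_iff_has_vector_derivative add.commute)
qed

lemma cont': "continuous_on {0..L} c'"
  using der2 has_vector_derivative_continuous continuous_on_eq_continuous_within by blast

text \<open>
  The squared distance to \<open>p\<close> is strictly convex along the curve as long as it is less than 1.
\<close>
lemma tangent_circle_local:
  assumes m: "0 < m" "m < L" and tan: "(c m - p) \<bullet> c' m = 0" and r: "norm (c m - p) \<le> \<rho>"
    and u: "u \<in> {0..L}" "u \<noteq> m" "\<bar>u - m\<bar> < 1 - \<rho>"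
  shows "norm (c m - p) < norm (c u - p)"
proof -
  let ?F = "\<lambda>u. (c u - p) \<bullet> (c u - p)" and ?G = "\<lambda>u. (c u - p) \<bullet> c' u"
  \<comment> \<open>At unit speed the curve moves by less than \<open>1 - \<rho>\<close>, so its
    distance from \<open>p\<close> stays below 1. The curvature bound and Cauchy-Schwarz then make
    this half second derivative positive.\<close>
  have pos: "1 + (c x - p) \<bullet> c'' x > 0" if "x \<in> {0..L}" "\<bar>x - m\<bar> < 1 - \<rho>" for x
  proof -
    have "norm (c x - p) \<le> norm (c x - c m) + norm (c m - p)"
      using norm_triangle_ineq[of "c x - c m" "c m - p"] by simp
    also have "\<dots> < 1" using dist_c_le[of x m] that m r by simp
    finally have "norm (c x - p) < 1" .
    moreover have "\<bar>(c x - p) \<bullet> c'' x\<bar> \<le> norm (c x - p) * norm (c'' x)"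
      by (rule Cauchy_Schwarz_ineq2)
    moreover have "norm (c x - p) * norm (c'' x) \<le> norm (c x - p)"
      using curv[OF that(1)] by (simp add: mult_left_le)
    ultimately show ?thesis by linarith
  qed
  have con: "continuous_on {0..L} ?F" "continuous_on {0..L} ?G"
    by (intro continuous_intros cont cont')+
  have "?F m < ?F u"
  \<comment> \<open>\<open>?G\<close>, half the derivative of \<open>?F\<close>, vanishes at
    \<open>m\<close> and increases near it. Hence \<open>?F\<close> grows away from \<open>m\<close>
    on either side.\<close>
  proof (cases "m < u")
    case True
    have G: "?G x > 0" if "m < x" "x < u" for x
    proof -
      have "?G m < ?G x"
      proof (rule DERIV_pos_imp_increasing_open[OF that(1)])
        fix y assume "m < y" "y < x"
        then show "\<exists>d. (?G has_real_derivative d) (at y) \<and> 0 < d"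
          using dist_sq_deriv(2)[of y p] pos[of y] that m u by auto
      qed (use that m u in \<open>auto intro: continuous_on_subset[OF con(2)]\<close>)
      then show ?thesis using tan by simp
    qed
    show ?thesis
    proof (rule DERIV_pos_imp_increasing_open[OF True])
      fix y assume "m < y" "y < u"
      then show "\<exists>d. (?F has_real_derivative d) (at y) \<and> 0 < d"
        using dist_sq_deriv(1)[of y p] G[of y] m u by (auto intro!: exI[of _ "2 * ?G y"])
    qed (use m u in \<open>auto intro: continuous_on_subset[OF con(1)]\<close>)
  next
    case False
    then have um: "u < m" using u by simp
    have G: "?G x < 0" if "u < x" "x < m" for x
    proof -
      have "?G x < ?G m"
      proof (rule DERIV_pos_imp_increasing_open[OF that(2)])
        fix y assume "x < y" "y < m"
        then show "\<exists>d. (?G has_real_derivative d) (at y) \<and> 0 < d"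
          using dist_sq_deriv(2)[of y p] pos[of y] that m u by auto
      qed (use that m u in \<open>auto intro: continuous_on_subset[OF con(2)]\<close>)
      then show ?thesis using tan by simp
    qed
    show ?thesis
    proof (rule DERIV_neg_imp_decreasing_open[OF um])
      fix y assume "u < y" "y < m"
      then show "\<exists>d. (?F has_real_derivative d) (at y) \<and> d < 0"
        using dist_sq_deriv(1)[of y p] G[of y] m u by (auto intro!: exI[of _ "2 * ?G y"])
    qed (use m u in \<open>auto intro: continuous_on_subset[OF con(1)]\<close>)
  qed
  then show ?thesis by (simp add: norm_lt)
qed

text \<open>First-order condition for a minimum of the squared distance. The parameter has to be
  interior, since at the base the minimum is only one-sided in the parameter.\<close>

lemma nearest_point_normal:
  assumes m: "0 < m" "m < L" and p: "nearest_point trace p (c m)"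
  shows "(c m - p) \<bullet> c' m = 0"
proof -
  let ?F = "\<lambda>u. (c u - p) \<bullet> (c u - p)"
  have "?F m \<le> ?F y" if "\<bar>m - y\<bar> < min m (L - m)" for y
  proof -
    have "c y \<in> trace" using that by (intro imageI) auto
    then have "dist p (c m) \<le> dist p (c y)" using p nearest_pointD by blast
    then have "norm (c m - p) \<le> norm (c y - p)" by (simp add: dist_norm norm_minus_commute)
    then show ?thesis by (simp only: norm_le)
  qed
  then have "2 * ((c m - p) \<bullet> c' m) = 0"
    using m by (intro DERIV_local_min[OF dist_sq_deriv(1)[OF m], of "min m (L - m)"]) auto
  then show ?thesis by simp
qed

text \<open>The two touching points are equally far from \<open>q\<close>, whereas all other points
  with parameters near \<open>m\<close> are strictly farther away by
  \<open>tangent_circle_local\<close>.\<close>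

lemma touching_params_apart:
  assumes r: "infdist q trace \<le> \<rho>" and m: "0 < m" "m < L"
    and qm: "nearest_point trace q (c m)" and qu: "nearest_point trace q (c u)"
    and u: "u \<in> {0..L}" "u \<noteq> m"
  shows "1 - \<rho> \<le> \<bar>u - m\<bar>"
proof (rule ccontr)
  assume "\<not> ?thesis"
  then have "norm (c m - q) < norm (c u - q)"
    using r qm by (intro tangent_circle_local[OF m nearest_point_normal[OF m qm] _ u])
      (auto simp: nearest_point_def dist_norm norm_minus_commute)
  then show False
    using qm qu by (simp add: nearest_point_def dist_norm norm_minus_commute)
qed

section \<open>Inflating a disc until it touches the loop twice\<close>

text \<open>The circles tangent at \<open>c m\<close> on the side of \<open>p\<close> form a family
  with centres \<open>z r\<close>. For radii up to \<open>\<rho>\<close>, parameters close to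
  \<open>m\<close> cause no obstruction, so the largest admissible radius is governed by the maximum
  of \<open>f\<close> over the remaining compact set of parameters.\<close>

lemma inflate_touching_disc:
  assumes \<rho>: "\<rho> < 1" "\<And>q. q \<in> inside trace \<Longrightarrow> infdist q trace < \<rho>"
    and m: "0 < m" "m < L" and p: "p \<in> inside trace" "nearest_point trace p (c m)"
  obtains q u where "q \<in> inside trace" "u \<in> {0..L}" "1 - \<rho> \<le> \<bar>u - m\<bar>"
    "nearest_point trace q (c m)" "nearest_point trace q (c u)"
proof -
  define d where "d = dist p (c m)"
  have cm: "c m \<in> trace" using m by auto
  then have "p \<noteq> c m" using p(1) inside_no_overlap[of trace] by blast
  then have d: "d > 0" by (simp add: d_def)
  have rho0: "0 < \<rho>" using \<rho>(2)[OF p(1)] infdist_nonneg[of p trace] by linarith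
  define n where "n = (p - c m) /\<^sub>R d"
  have n1: "norm n = 1" using d by (simp add: n_def d_def dist_norm)
  have p_eq: "p = c m + d *\<^sub>R n" using d by (simp add: n_def)
  have nt: "n \<bullet> c' m = 0"
    using nearest_point_normal[OF m p(2)] by (simp add: n_def inner_diff_left)
  define z where "z r = c m + r *\<^sub>R n" for r
  have dz: "dist (z r) (c m) = \<bar>r\<bar>" for r by (simp add: z_def dist_norm n1)
  \<comment> \<open>\<open>1 / f u\<close> is the radius of the circle through \<open>c u\<close> that touches the curve at \<open>c m\<close> on the side of \<open>p\<close>.\<close>
  define f where "f u = 2 * ((c u - c m) \<bullet> n) / (norm (c u - c m))\<^sup>2" for u
  have zf: "r \<le> dist (z r) (c u) \<longleftrightarrow> r * f u \<le> 1"
    "dist (z r) (c u) = r \<longleftrightarrow> r * f u = 1" if "0 < r" "c u \<noteq> c m" for r u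
  proof -
    have pos: "(norm (c u - c m))\<^sup>2 > 0" using that by simp
    have sq: "(dist (z r) (c u))\<^sup>2 = (norm (c u - c m))\<^sup>2 - 2 * r * ((c u - c m) \<bullet> n) + r\<^sup>2"
    proof -
      have "dist (z r) (c u) = norm ((c u - c m) - r *\<^sub>R n)"
        by (simp add: z_def dist_norm norm_minus_commute algebra_simps)
      then have "(dist (z r) (c u))\<^sup>2 = ((c u - c m) - r *\<^sub>R n) \<bullet> ((c u - c m) - r *\<^sub>R n)"
        by (simp add: power2_norm_eq_inner)
      also have "\<dots> = (c u - c m) \<bullet> (c u - c m) - 2 * r * ((c u - c m) \<bullet> n) + r\<^sup>2 * (n \<bullet> n)"
        unfolding inner_commute[of n "c u - c m"] inner_diff_left[of _ "r *\<^sub>R n"] inner_diff_right[of _ _ "r *\<^sub>R n"]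
          inner_scaleR_left inner_scaleR_right power2_eq_square
        by (simp add: right_diff_distrib mult.assoc)
      finally show ?thesis using n1 by (simp add: power2_norm_eq_inner norm_eq_1)
    qed
    have "r \<le> dist (z r) (c u) \<longleftrightarrow> r\<^sup>2 \<le> (dist (z r) (c u))\<^sup>2"
      using that by (simp add: power_mono_iff)
    also have "\<dots> \<longleftrightarrow> r * f u \<le> 1"
      unfolding sq f_def using pos by (simp add: field_simps)
    finally show "r \<le> dist (z r) (c u) \<longleftrightarrow> r * f u \<le> 1" .
    have "dist (z r) (c u) = r \<longleftrightarrow> (dist (z r) (c u))\<^sup>2 = r\<^sup>2"
      using that by (simp add: power2_eq_iff_nonneg)
    also have "\<dots> \<longleftrightarrow> r * f u = 1"
      unfolding sq f_def using pos by (auto simp: field_simps)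
    finally show "dist (z r) (c u) = r \<longleftrightarrow> r * f u = 1" .
  qed
  have near_z: "nearest_point trace (z r) (c m) \<and> z r \<in> inside trace"
    if r: "0 < r" "r \<le> \<rho>" and far: "\<And>u. u \<in> {0..L} \<Longrightarrow> 1 - \<rho> \<le> \<bar>u - m\<bar> \<Longrightarrow> r \<le> dist (z r) (c u)" for r
  proof
    have "r \<le> dist (z r) (c u)" if u: "u \<in> {0..L}" for u
    proof (cases "1 - \<rho> \<le> \<bar>u - m\<bar> \<or> u = m")
      case True
      then show ?thesis using far[OF u] r dz[of r] by auto
    next
      case False
      have "norm (c m - z r) < norm (c u - z r)"
        using False r n1 nt u by (intro tangent_circle_local[OF m]) (auto simp: z_def)
      then show ?thesis using r dz[of r] by (simp add: dist_norm norm_minus_commute)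
    qed
    then show nz: "nearest_point trace (z r) (c m)"
      using cm dz r by (auto intro!: nearest_pointI)
    \<comment> \<open>The point at distance \<open>e\<close> from \<open>c m\<close> along
      \<open>n\<close> belongs to both balls. The ball about \<open>z r\<close> is thereby linked to
      a ball known to be inside.\<close>
    define e where "e = min d r"
    have "c m + e *\<^sub>R n \<in> ball p d" "c m + e *\<^sub>R n \<in> ball (z r) r"
    proof -
      have "dist p (c m + e *\<^sub>R n) = norm ((d - e) *\<^sub>R n)"
        by (subst p_eq) (simp add: dist_norm scaleR_left_diff_distrib)
      moreover have "dist (z r) (c m + e *\<^sub>R n) = norm ((r - e) *\<^sub>R n)"
        by (simp add: z_def dist_norm scaleR_left_diff_distrib)
      ultimately show "c m + e *\<^sub>R n \<in> ball p d" "c m + e *\<^sub>R n \<in> ball (z r) r"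
        using d r n1 by (simp_all add: e_def)
    qed
    moreover have "ball p d \<subseteq> inside trace"
      using ball_nearest_point_inside[OF p(2,1)] by (simp add: d_def)
    moreover have "ball (z r) r \<inter> trace = {}"
      using nearest_pointD[OF nz] dz[of r] r by fastforce
    ultimately have "ball (z r) r \<subseteq> inside trace"
      by (intro connected_subset_inside[of _ _ "c m + e *\<^sub>R n"]) auto
    then show "z r \<in> inside trace" using r by auto
  qed
  \<comment> \<open>Removing the parameters near \<open>m\<close> keeps the denominator of
    \<open>f\<close> from vanishing, so \<open>f\<close> is continuous on a compact set.\<close>
  define K where "K = {0..L} \<inter> {u. 1 - \<rho> \<le> \<bar>u - m\<bar>}"
  have ne: "c u \<noteq> c m" if "u \<in> K" for u
    using that interior_param_unique[of u m] m \<rho>(1) by (auto simp: K_def)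
  \<comment> \<open>Otherwise radius \<open>\<rho>\<close> itself would be admissible, giving an
    inside point at distance \<open>\<rho>\<close> from the loop.\<close>
  have "\<not> (\<forall>u\<in>K. f u \<le> 1 / \<rho>)"
  proof
    assume "\<forall>u\<in>K. f u \<le> 1 / \<rho>"
    then have "\<rho> \<le> dist (z \<rho>) (c u)" if "u \<in> {0..L}" "1 - \<rho> \<le> \<bar>u - m\<bar>" for u
      using that zf(1)[of \<rho> u] rho0 ne[of u] by (auto simp: K_def field_simps)
    then have "nearest_point trace (z \<rho>) (c m) \<and> z \<rho> \<in> inside trace"
      using rho0 by (intro near_z) auto
    then show False using \<rho>(2)[of "z \<rho>"] dz[of \<rho>] rho0 by (simp add: nearest_point_def)
  qed
  then obtain v where v: "v \<in> K" "1 / \<rho> < f v" by force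
  have "closed {u. 1 - \<rho> \<le> \<bar>u - m\<bar>}"
    by (intro closed_Collect_le continuous_intros)
  then have "compact K" unfolding K_def by (intro compact_Int_closed) auto
  moreover have "continuous_on K f"
    unfolding f_def using ne
    by (intro continuous_intros continuous_on_subset[OF cont]) (auto simp: K_def)
  ultimately obtain u where u: "u \<in> K" "\<And>w. w \<in> K \<Longrightarrow> f w \<le> f u"
    using continuous_attains_sup[of K f] v(1) by blast
  \<comment> \<open>The maximum of \<open>f\<close> corresponds to the smallest obstructing radius,
    that is, to the first contact.\<close>
  define r where "r = 1 / f u"
  have fu: "1 / \<rho> < f u" using u(2)[OF v(1)] v(2) by simp
  then have fu0: "f u > 0" using rho0 by (smt (verit) divide_pos_pos)
  have r: "0 < r" "r \<le> \<rho>" using fu fu0 rho0 by (auto simp: r_def field_simps)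
  have "nearest_point trace (z r) (c m) \<and> z r \<in> inside trace"
  proof (rule near_z[OF r])
    fix w assume "w \<in> {0..L}" "1 - \<rho> \<le> \<bar>w - m\<bar>"
    then have w: "w \<in> K" by (simp add: K_def)
    have "r * f w \<le> 1" using u(2)[OF w] fu0 by (simp add: r_def)
    then show "r \<le> dist (z r) (c w)" using zf(1)[OF r(1) ne[OF w]] by simp
  qed
  moreover have "dist (z r) (c u) = r"
    using zf(2)[OF r(1) ne[OF u(1)]] fu0 by (simp add: r_def)
  ultimately have "nearest_point trace (z r) (c u)"
    using dz[of r] r u(1) by (auto simp: nearest_point_def K_def)
  then show thesis
    using that[of "z r" u] \<open>nearest_point trace (z r) (c m) \<and> z r \<in> inside trace\<close> u(1)
    by (auto simp: K_def)
qed

text \<open>The midpoint \<open>c m0\<close> has positive distance from the rest of the loop. An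
  inside point close enough to it therefore has its nearest point at a parameter strictly between
  \<open>s\<close> and \<open>t\<close>, and inflating that disc gives the second contact.\<close>

lemma touching_disc_between:
  assumes \<rho>: "\<rho> < 1" "\<And>q. q \<in> inside trace \<Longrightarrow> infdist q trace < \<rho>"
    and st: "0 \<le> s" "s < t" "t \<le> L"
  obtains q m u where "s < m" "m < t" "q \<in> inside trace" "u \<in> {0..L}" "1 - \<rho> \<le> \<bar>u - m\<bar>"
    "nearest_point trace q (c m)" "nearest_point trace q (c u)"
proof -
  define K where "K = c ` ({0..s} \<union> {t..L})"
  define m0 where "m0 = (s + t) / 2"
  have m0: "s < m0" "m0 < t" using st by (auto simp: m0_def)
  have "compact K" unfolding K_def
    using st by (intro compact_continuous_image continuous_on_subset[OF cont] compact_Un) auto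
  then have "closed K" by (rule compact_imp_closed)
  moreover have "c m0 \<notin> K"
  proof
    assume "c m0 \<in> K"
    then obtain x where "x \<in> {0..s} \<union> {t..L}" "c m0 = c x" unfolding K_def by blast
    then show False using interior_param_unique[of x m0] m0 st by auto
  qed
  ultimately obtain e where e: "e > 0" "ball (c m0) e \<inter> K = {}"
    by (metis Compl_iff disjoint_eq_subset_Compl open_Compl open_contains_ball)
  have "c m0 \<in> closure (inside trace)"
    using closure_inside_trace m0 st by auto
  \<comment> \<open>Both \<open>p\<close> and its nearest point cost at most half of
    \<open>e\<close>, which keeps the nearest point out of \<open>K\<close>.\<close>
  then obtain p where p: "p \<in> inside trace" "dist p (c m0) < e / 2"
    using e(1) by (meson closure_approachable half_gt_zero)
  have "trace \<noteq> {}" using L by auto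
  then obtain w where w: "w \<in> trace" "infdist p trace = dist p w"
    using infdist_attains_inf[OF closed_trace] by blast
  then obtain m where m: "w = c m" "m \<in> {0..L}" by blast
  have np: "nearest_point trace p (c m)" using w m by (simp add: nearest_point_def)
  have "c m0 \<in> trace" using m0 st by auto
  then have "dist p (c m) < e / 2" using nearest_pointD[OF np] p(2) by fastforce
  then have "dist (c m0) (c m) < e" using dist_triangle[of "c m0" "c m" p] p(2)
    by (simp add: dist_commute)
  then have "c m \<notin> K" using e(2) by auto
  then have "m \<notin> {0..s} \<union> {t..L}" unfolding K_def by blast
  then have "s < m" "m < t" using m by auto
  then have m0L: "0 < m" "m < L" using st by auto
  show thesis
    by (rule inflate_touching_disc[OF \<rho> m0L p(1) np]) (use that \<open>s < m\<close> \<open>m < t\<close> in blast)+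
qed

section \<open>The closest pair of touching parameters and the inradius\<close>

lemma inradius_not_below_one:
  assumes \<rho>: "\<rho> < 1"
  shows "\<exists>q \<in> inside trace. \<rho> \<le> infdist q trace"
proof (rule ccontr)
  assume "\<not> ?thesis"
  then have small: "\<And>q. q \<in> inside trace \<Longrightarrow> infdist q trace < \<rho>" by force
  \<comment> \<open>The bound \<open>1 - \<rho>\<close> keeps the two parameters apart and thereby makes the set of touching triples compact.\<close>
  define T where "T = ({0..L} \<times> {0..L} \<times> closure (inside trace)) \<inter>
    {(s,t,q). 1 - \<rho> \<le> t - s \<and> dist q (c s) = infdist q trace \<and> dist q (c t) = infdist q trace}"
  have TI: "(x, y, q) \<in> T"
    if "x \<in> {0..L}" "y \<in> {0..L}" "q \<in> inside trace" "1 - \<rho> \<le> y - x"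
      "nearest_point trace q (c x)" "nearest_point trace q (c y)" for x y q
    using that closure_subset[of "inside trace"] by (auto simp: T_def nearest_point_def)
  have TI': "\<exists>s' t'. (s', t', q) \<in> T \<and> t' - s' = \<bar>y - x\<bar>"
    if "x \<in> {0..L}" "y \<in> {0..L}" "q \<in> inside trace" "1 - \<rho> \<le> \<bar>y - x\<bar>"
      "nearest_point trace q (c x)" "nearest_point trace q (c y)" for x y q
  proof (cases "x \<le> y")
    case True
    then show ?thesis using TI[of x y q] that by force
  next
    case False
    then show ?thesis using TI[of y x q] that by force
  qed
  \<comment> \<open>This triple shows that \<open>T\<close> is nonempty. Since \<open>m0\<close> is
    interior its gap is below \<open>L\<close>, which rules out that the minimal pair consists of
    the two parameters of the base.\<close>
  obtain q0 m0 u0 where "0 < m0" "m0 < L" "q0 \<in> inside trace" "u0 \<in> {0..L}" "1 - \<rho> \<le> \<bar>u0 - m0\<bar>"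
    "nearest_point trace q0 (c m0)" "nearest_point trace q0 (c u0)"
    using touching_disc_between[OF \<rho> small, of 0 L] L by blast
  then obtain s0 t0 where 0: "(s0, t0, q0) \<in> T" "t0 - s0 < L"
    using TI'[of m0 u0 q0] by force
  have "compact T"
  proof -
    let ?B = "{0..L} \<times> {0..L} \<times> closure (inside trace)"
    have cB: "compact ?B" using inside_trace(3) by (intro compact_Times) auto
    have c1: "continuous_on ?B (\<lambda>w. c (fst w))" "continuous_on ?B (\<lambda>w. c (fst (snd w)))"
      by (rule continuous_on_compose2[OF cont]; force intro!: continuous_intros)+
    define d1 where "d1 w = dist (snd (snd w)) (c (fst w)) - infdist (snd (snd w)) trace" for w :: "real \<times> real \<times> complex"
    define d2 where "d2 w = dist (snd (snd w)) (c (fst (snd w))) - infdist (snd (snd w)) trace" for w :: "real \<times> real \<times> complex"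
    have sn: "continuous_on ?B (\<lambda>w. snd (snd w))" by (intro continuous_on_snd continuous_on_id)
    have "continuous_on ?B d1" "continuous_on ?B d2"
      unfolding d1_def d2_def
      by (rule continuous_on_diff[OF continuous_on_dist[OF sn c1(1)] continuous_on_infdist[OF sn]],
          rule continuous_on_diff[OF continuous_on_dist[OF sn c1(2)] continuous_on_infdist[OF sn]])
    moreover have "continuous_on ?B (\<lambda>w. fst (snd w) - fst w)"
      by (intro continuous_on_diff continuous_on_fst continuous_on_snd continuous_on_id)
    ultimately have "closed (?B \<inter> d1 -` {0})" "closed (?B \<inter> d2 -` {0})"
      "closed (?B \<inter> (\<lambda>w. fst (snd w) - fst w) -` {1 - \<rho>..})"
      using compact_imp_closed[OF cB] by (auto intro!: continuous_closed_preimage)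
    then have "compact (?B \<inter> ((?B \<inter> d1 -` {0}) \<inter> (?B \<inter> d2 -` {0}) \<inter> (?B \<inter> (\<lambda>w. fst (snd w) - fst w) -` {1 - \<rho>..})))"
      by (rule compact_Int_closed[OF cB closed_Int[OF closed_Int]])
    also have "?B \<inter> ((?B \<inter> d1 -` {0}) \<inter> (?B \<inter> d2 -` {0}) \<inter> (?B \<inter> (\<lambda>w. fst (snd w) - fst w) -` {1 - \<rho>..})) = T"
      by (auto simp: T_def d1_def d2_def)
    finally show ?thesis .
  qed
  moreover have "continuous_on T (\<lambda>w. fst (snd w) - fst w)" by (intro continuous_intros)
  ultimately obtain w where w: "w \<in> T" "\<And>w'. w' \<in> T \<Longrightarrow> fst (snd w) - fst w \<le> fst (snd w') - fst w'"
    using continuous_attains_inf[of T "\<lambda>w. fst (snd w) - fst w"] 0(1) by blast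
  obtain s t q where w_eq: "w = (s, t, q)" using prod_cases3 by blast
  have minimal: "t - s \<le> t' - s'" if "(s', t', q') \<in> T" for s' t' q'
    using w(2)[OF that] by (simp add: w_eq)
  have st: "s \<in> {0..L}" "t \<in> {0..L}" "1 - \<rho> \<le> t - s" and cl: "q \<in> closure (inside trace)"
    and qs: "nearest_point trace q (c s)" and qt: "nearest_point trace q (c t)"
    using w(1) by (auto simp: T_def w_eq nearest_point_def)
  have "s < t" using st \<rho> by simp
  moreover have "t - s < L" using minimal[OF 0(1)] 0(2) by simp
  ultimately have ne: "c s \<noteq> c t" using simple[of s t] st by auto
  \<comment> \<open>For compactness \<open>T\<close> admits centres on the loop. Such a centre would
    be its own only nearest point, contrary to \<open>c s\<close> and \<open>c t\<close> being
    distinct.\<close>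
  have "q \<notin> trace"
  proof
    assume "q \<in> trace"
    then have "q = c s" "q = c t" using qs qt by (auto simp: nearest_point_def)
    then show False using ne by simp
  qed
  then have q_in: "q \<in> inside trace" using cl closure_inside_trace by blast
  obtain q' m u where m: "s < m" "m < t" and q': "q' \<in> inside trace" and u: "u \<in> {0..L}" "1 - \<rho> \<le> \<bar>u - m\<bar>"
    and qm: "nearest_point trace q' (c m)" and qu: "nearest_point trace q' (c u)"
    using touching_disc_between[OF \<rho> small _ \<open>s < t\<close>] st by (metis atLeastAtMost_iff)
  have m0L: "0 < m" "m < L" using m st by auto
  \<comment> \<open>As \<open>m\<close> is strictly between \<open>s\<close> and \<open>t\<close>,
    the gap between \<open>v\<close> and \<open>m\<close> is less than \<open>t - s\<close>; by
    \<open>touching_params_apart\<close> it is large enough for a triple in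
    \<open>T\<close>.\<close>
  have shorter: False if v: "v \<in> {s..t}" "v \<noteq> m" "nearest_point trace q' (c v)" for v
  proof -
    have "1 - \<rho> \<le> \<bar>v - m\<bar>"
      using touching_params_apart[of q' \<rho> m v] small[OF q'] m0L qm v st by auto
    then obtain s' t' where "(s', t', q') \<in> T" "t' - s' = \<bar>v - m\<bar>"
      using TI'[of m v q'] v st q' qm m by auto
    then show False using minimal v(1) m by (smt (verit) atLeastAtMost_iff)
  qed
  show False
  \<comment> \<open>The case split concerns points rather than parameters: if \<open>c u\<close> is
    the base, its other parameter may be the one in \<open>{s..t}\<close>.\<close>
  proof (cases "c u \<in> c ` {s..t}")
    case True
    then obtain v where v: "v \<in> {s..t}" "c u = c v" by blast
    have "c u \<noteq> c m"
      using interior_param_unique[of u m] m0L u \<rho> by auto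
    then show False using shorter[of v] v qu by auto
  next
    case False
    \<comment> \<open>The coinciding discs touch at \<open>s\<close> as well as at \<open>m\<close>,
      which again is a shorter pair.\<close>
    have "q = q'"
      using double_touch_eq[OF _ m _ ne q_in qs qt q' qm qu False] st by auto
    then show False using shorter[of s] qs m by auto
  qed
qed

text \<open>The distance to the loop attains its maximum on the compact closure of the inside. It is
  at least 1 because it is no less than any \<open>\<rho>\<close> below 1, and taking closures turns
  the open disc into the closed one.\<close>

lemma unit_disc_inside:
  "\<exists>p. cball p 1 \<subseteq> inside trace \<union> trace"
proof -
  let ?R = "closure (inside trace)"
  have "compact ?R" "?R \<noteq> {}" using inside_trace by auto
  moreover have "continuous_on ?R (\<lambda>q. infdist q trace)"
    by (rule continuous_on_infdist[OF continuous_on_id])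
  ultimately have "\<exists>p\<in>?R. \<forall>q\<in>?R. infdist q trace \<le> infdist p trace"
    by (rule continuous_attains_sup)
  then obtain p where p: "p \<in> ?R" "\<And>q. q \<in> ?R \<Longrightarrow> infdist q trace \<le> infdist p trace"
    by (elim bexE) simp
  have ge1: "1 \<le> infdist p trace"
  proof (rule ccontr)
    assume "\<not> ?thesis"
    then obtain \<rho> where "infdist p trace < \<rho>" "\<rho> < 1" using dense not_le by metis
    then show False
      using inradius_not_below_one[of \<rho>] p(2) closure_subset by fastforce
  qed
  then have "p \<notin> trace" by auto
  then have p_in: "p \<in> inside trace" using p(1) closure_inside_trace by blast
  have "ball p 1 \<subseteq> inside trace"
  proof (rule connected_subset_inside[OF _ _ _ p_in])
    show "ball p 1 \<inter> trace = {}"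
      using ge1 infdist_le[of _ trace p] by fastforce
  qed auto
  then have "closure (ball p 1) \<subseteq> closure (inside trace)" by (rule closure_mono)
  then show ?thesis using closure_inside_trace by auto
qed

end

section \<open>Reparametrization by arc length\<close>

locale arc_length_loop =
  fixes a b :: real and \<gamma> :: "real \<Rightarrow> real^2"
  assumes loop: "smooth_plane_loop a b \<gamma>"
begin

lemma ab: "a < b"
  using loop by (simp add: smooth_plane_loop_def)

text \<open>Fixes one witness of smoothness; on \<open>{a..b}\<close> its values are determined by
  \<open>\<gamma>\<close>.\<close>

definition deriv :: "nat \<Rightarrow> real \<Rightarrow> real^2" where
  "deriv = (SOME D. D 0 = \<gamma> \<and>
        (\<forall>n. \<forall>t\<in>{a..b}. (D n has_vector_derivative D (Suc n) t) (at t within {a..b})))"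

lemma deriv_0: "deriv 0 = \<gamma>"
  and deriv_Suc: "t \<in> {a..b} \<Longrightarrow> (deriv n has_vector_derivative deriv (Suc n) t) (at t within {a..b})"
proof -
  have ex: "\<exists>D. D 0 = \<gamma> \<and>
        (\<forall>n. \<forall>t\<in>{a..b}. (D n has_vector_derivative D (Suc n) t) (at t within {a..b}))"
    using loop unfolding smooth_plane_loop_def smooth_on_interval_def by (elim conjE)
  note D = someI_ex[OF ex, folded deriv_def]
  show "deriv 0 = \<gamma>" by (rule conjunct1[OF D])
  show "t \<in> {a..b} \<Longrightarrow> (deriv n has_vector_derivative deriv (Suc n) t) (at t within {a..b})"
    by (rule bspec[OF spec[OF conjunct2[OF D]]])
qed

lemma velocity_eq: "t \<in> {a..b} \<Longrightarrow> velocity a b \<gamma> t = deriv 1 t"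
  unfolding velocity_def
  using vector_derivative_within_closed_interval[OF ab] deriv_Suc[of t 0] deriv_0 by simp

lemma deriv_nonzero: "t \<in> {a..b} \<Longrightarrow> deriv 1 t \<noteq> 0"
  using velocity_eq loop by (simp add: smooth_plane_loop_def)

abbreviation \<sigma> where "\<sigma> \<equiv> arc_length a b \<gamma>"
abbreviation \<tau> where "\<tau> \<equiv> the_inv_into {a..b} \<sigma>"
abbreviation L where "L \<equiv> \<sigma> b"

lemma \<sigma>_deriv:
  assumes t: "t \<in> {a..b}"
  shows "(\<sigma> has_real_derivative norm (deriv 1 t)) (at t within {a..b})"
proof -
  have "continuous_on {a..b} (deriv 1)"
    using deriv_Suc[of _ 1] has_vector_derivative_continuous continuous_on_eq_continuous_within by blast
  then have "continuous_on {a..b} (\<lambda>t. norm (deriv 1 t))" by (rule continuous_on_norm)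
  moreover have "\<sigma> x = integral {a..x} (\<lambda>t. norm (deriv 1 t))" if "x \<in> {a..b}" for x
    unfolding arc_length_def using that by (intro integral_cong) (simp add: velocity_eq)
  ultimately show ?thesis
    unfolding has_real_derivative_iff_has_vector_derivative
    by (intro has_vector_derivative_transform[OF t _ integral_has_vector_derivative[OF _ t]])
qed

lemma \<sigma>_cont: "continuous_on {a..b} \<sigma>"
  by (rule DERIV_continuous_on[OF \<sigma>_deriv])

lemma \<sigma>_mono:
  assumes "a \<le> s" "s < t" "t \<le> b"
  shows "\<sigma> s < \<sigma> t"
proof (rule DERIV_pos_imp_increasing_open[OF assms(2)])
  fix x assume x: "s < x" "x < t"
  then have "(\<sigma> has_real_derivative norm (deriv 1 x)) (at x)"
    using \<sigma>_deriv[of x] assms by (simp add: at_within_Icc_at)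
  moreover have "norm (deriv 1 x) > 0" using deriv_nonzero[of x] x assms by simp
  ultimately show "\<exists>y. (\<sigma> has_real_derivative y) (at x) \<and> 0 < y" by blast
qed (use assms in \<open>auto intro: continuous_on_subset[OF \<sigma>_cont]\<close>)

lemma \<sigma>_a: "\<sigma> a = 0"
  by (simp add: arc_length_def)

lemma L_pos: "0 < L"
  using \<sigma>_mono[of a b] ab \<sigma>_a by simp

lemma \<sigma>_inj: "inj_on \<sigma> {a..b}"
  by (rule linorder_inj_onI) (use \<sigma>_mono in \<open>force+\<close>)

lemma \<sigma>_image: "\<sigma> ` {a..b} = {0..L}"
proof
  show "\<sigma> ` {a..b} \<subseteq> {0..L}"
    using \<sigma>_mono \<sigma>_a by (auto simp: less_eq_real_def) (metis order_le_less)+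
  show "{0..L} \<subseteq> \<sigma> ` {a..b}"
  proof
    fix y assume "y \<in> {0..L}"
    then obtain x where "a \<le> x" "x \<le> b" "\<sigma> x = y"
      using IVT'[of \<sigma> a y b] \<sigma>_cont \<sigma>_a ab by auto
    then show "y \<in> \<sigma> ` {a..b}" by auto
  qed
qed

lemma \<tau>_\<sigma>: "t \<in> {a..b} \<Longrightarrow> \<tau> (\<sigma> t) = t"
  using the_inv_into_f_f[OF \<sigma>_inj] by blast

lemma \<sigma>_\<tau>: "x \<in> {0..L} \<Longrightarrow> \<sigma> (\<tau> x) = x"
  using f_the_inv_into_f[OF \<sigma>_inj] \<sigma>_image by blast

lemma \<tau>_image: "\<tau> ` {0..L} = {a..b}"
  using the_inv_into_onto[OF \<sigma>_inj] \<sigma>_image by simp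

lemma \<tau>_in: "x \<in> {0..L} \<Longrightarrow> \<tau> x \<in> {a..b}"
  using \<tau>_image by blast

text \<open>The inverse function rule, applied within the interval so that the ends are covered.
  Continuity of the inverse comes from compactness of \<open>{a..b}\<close>.\<close>

lemma \<tau>_deriv:
  assumes x: "x \<in> {0..L}"
  shows "(\<tau> has_vector_derivative inverse (norm (deriv 1 (\<tau> x)))) (at x within {0..L})"
proof -
  define t where "t = \<tau> x"
  have t: "t \<in> {a..b}" "x = \<sigma> t" using x \<tau>_in \<sigma>_\<tau> by (auto simp: t_def)
  let ?v = "norm (deriv 1 t)"
  have v: "?v \<noteq> 0" using deriv_nonzero[OF t(1)] by simp
  have "continuous_on (\<sigma> ` {a..b}) \<tau>"
    by (rule continuous_on_inv[OF \<sigma>_cont]) (auto simp: \<tau>_\<sigma>)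
  then have "continuous (at (\<sigma> t) within \<sigma> ` {a..b}) \<tau>"
    using t(1) by (simp add: continuous_on_eq_continuous_within)
  moreover have "(\<sigma> has_derivative (*) ?v) (at t within {a..b})"
    using \<sigma>_deriv[OF t(1)] by (simp add: has_field_derivative_def)
  moreover have "linear (\<lambda>h. h *\<^sub>R inverse ?v)" by (intro linearI) (auto simp: algebra_simps)
  moreover have "(\<lambda>h. h *\<^sub>R inverse ?v) \<circ> (*) ?v = id" using v by (auto simp: fun_eq_iff)
  ultimately have "(\<tau> has_derivative (\<lambda>h. h *\<^sub>R inverse ?v)) (at (\<sigma> t) within \<sigma> ` {a..b})"
    using t(1) \<tau>_\<sigma> by (intro has_derivative_inverse_within[where f' = "(*) ?v"]) auto
  then show ?thesis
    unfolding has_vector_derivative_def \<sigma>_image t(2)[symmetric] by (simp add: t_def)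
qed

lemma chain_\<tau>:
  assumes x: "x \<in> {0..L}" and f: "(f has_vector_derivative f') (at (\<tau> x) within {a..b})"
  shows "(f \<circ> \<tau> has_vector_derivative f' /\<^sub>R norm (deriv 1 (\<tau> x))) (at x within {0..L})"
  by (rule vector_diff_chain_within[OF \<tau>_deriv[OF x]]) (simp add: \<tau>_image f)

definition tangent where "tangent t = deriv 1 t /\<^sub>R norm (deriv 1 t)"

lemma tangent_differentiable:
  assumes t: "t \<in> {a..b}"
  shows "tangent differentiable (at t within {a..b})"
proof -
  have d: "deriv 1 differentiable (at t within {a..b})"
    using deriv_Suc[OF t, of 1] unfolding has_vector_derivative_def differentiable_def by blast
  have "norm differentiable (at (deriv 1 t))"
    using deriv_nonzero[OF t] by (rule differentiable_norm_at)
  then have "norm \<circ> deriv 1 differentiable (at t within {a..b})"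
    by (intro differentiable_chain_within[OF d]) (rule differentiable_at_withinI)
  then show ?thesis
    unfolding tangent_def o_def using d deriv_nonzero[OF t]
    by (intro differentiable_scaleR differentiable_inverse) auto
qed

definition c where "c = arc_length_param a b \<gamma>"

lemma c_eq: "c = \<gamma> \<circ> \<tau>"
  by (simp add: c_def arc_length_param_def)

lemma c_image: "c ` {0..L} = \<gamma> ` {a..b}"
  unfolding c_eq image_comp[symmetric] \<tau>_image ..

definition c' where "c' = tangent \<circ> \<tau>"

lemma c_deriv: "x \<in> {0..L} \<Longrightarrow> (c has_vector_derivative c' x) (at x within {0..L})"
  using chain_\<tau>[of x "deriv 0" "deriv 1 (\<tau> x)"] deriv_Suc[OF \<tau>_in, of x 0]
  by (simp add: c_eq c'_def tangent_def deriv_0)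

lemma norm_c': "x \<in> {0..L} \<Longrightarrow> norm (c' x) = 1"
  using deriv_nonzero[OF \<tau>_in, of x] by (simp add: c'_def tangent_def)

text \<open>Written with the iterated \<open>velocity\<close> of \<open>abs_curvature\<close>, so
  that the curvature bound carries over by unfolding. That it differentiates \<open>c'\<close> is
  proved separately.\<close>

definition c'' where "c'' x = velocity 0 L (velocity 0 L c) x"

lemma c'_deriv:
  assumes x: "x \<in> {0..L}"
  shows "(c' has_vector_derivative c'' x) (at x within {0..L})"
proof -
  have vel: "velocity 0 L c y = c' y" if "y \<in> {0..L}" for y
    unfolding velocity_def using vector_derivative_within_closed_interval[OF L_pos that c_deriv[OF that]] .
  have "(tangent has_vector_derivative vector_derivative tangent (at (\<tau> x) within {a..b})) (at (\<tau> x) within {a..b})"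
    using tangent_differentiable[OF \<tau>_in[OF x]] vector_derivative_works by blast
  from chain_\<tau>[OF x this] obtain d where d: "(c' has_vector_derivative d) (at x within {0..L})"
    unfolding c'_def by blast
  \<comment> \<open>The functions \<open>velocity 0 L c\<close> and \<open>c'\<close> are known to
    agree on \<open>{0..L}\<close>, which suffices for derivatives within that interval.\<close>
  then have "(velocity 0 L c has_vector_derivative d) (at x within {0..L})"
    by (rule has_vector_derivative_transform[OF x vel, rotated])
  then have "c'' x = d"
    unfolding c''_def velocity_def[of 0 L "velocity 0 L c"]
    by (rule vector_derivative_within_closed_interval[OF L_pos x])
  then show ?thesis using d by simp
qed

lemma norm_c'':
  assumes "\<forall>t\<in>{a..b}. abs_curvature a b \<gamma> t \<le> 1" "x \<in> {0..L}"
  shows "norm (c'' x) \<le> 1"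
proof -
  have "abs_curvature a b \<gamma> (\<tau> x) = norm (c'' x)"
    using assms(2) \<sigma>_\<tau> by (simp add: abs_curvature_def c''_def c_def Let_def)
  then show ?thesis using assms \<tau>_in by metis
qed

lemma c_closes: "c 0 = c L"
  using \<tau>_\<sigma>[of a] \<tau>_\<sigma>[of b] ab \<sigma>_a loop by (simp add: c_eq smooth_plane_loop_def)

lemma c_simple:
  assumes "simple_loop a b \<gamma>" "x \<in> {0..L}" "y \<in> {0..L}" "x < y" "c x = c y"
  shows "x = 0 \<and> y = L"
proof -
  have xy: "\<sigma> (\<tau> x) = x" "\<sigma> (\<tau> y) = y" using assms \<sigma>_\<tau> by auto
  then have "\<tau> x \<noteq> \<tau> y" using assms(4) by force
  then have "{\<tau> x, \<tau> y} = {a, b}"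
    using assms \<tau>_in unfolding simple_loop_def c_eq by simp
  then have "\<tau> x = a \<and> \<tau> y = b \<or> \<tau> x = b \<and> \<tau> y = a" by (simp add: doubleton_eq_iff)
  then show ?thesis using xy \<sigma>_a L_pos assms(4) by force
qed

end

section \<open>Transfer between \<open>real^2\<close> and \<open>complex\<close> by a linear
  isometry\<close>

theorem theorem7p14:
  fixes \<gamma> :: "real \<Rightarrow> real^2" and a b :: real
  assumes "smooth_plane_loop a b \<gamma>"
    and "simple_loop a b \<gamma>"
    and "\<forall>t\<in>{a..b}. abs_curvature a b \<gamma> t \<le> 1"
  shows "\<exists>p. cball p 1 \<subseteq> bounded_region a b \<gamma>"
proof -
  interpret arc_length_loop a b \<gamma> using assms(1) by unfold_locales
  \<comment> \<open>Both spaces are Euclidean of dimension 2. Being linear, \<open>\<phi>\<close>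
    commutes with differentiation; being an isometry, it preserves unit speed, the curvature bound
    and discs.\<close>
  obtain \<phi> :: "real^2 \<Rightarrow> complex" and \<psi> where lin: "linear \<phi>" "linear \<psi>"
    and norm: "\<And>x. norm (\<phi> x) = norm x" "\<And>y. norm (\<psi> y) = norm y"
    and inv: "\<And>x. \<psi> (\<phi> x) = x" "\<And>y. \<phi> (\<psi> y) = y"
    using isomorphisms_UNIV_UNIV[where 'M = "real^2" and 'N = complex] by auto
  have bl: "bounded_linear \<phi>" using lin(1) linear_conv_bounded_linear by blast
  note der = bounded_linear.has_vector_derivative[OF bl]
  interpret unit_speed_loop L "\<lambda>x. \<phi> (c x)" "\<lambda>x. \<phi> (c' x)" "\<lambda>x. \<phi> (c'' x)"
  proof
    show "continuous_on {0..L} (\<lambda>x. \<phi> (c x))"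
      using der[OF c_deriv] has_vector_derivative_continuous continuous_on_eq_continuous_within by blast
    fix x y assume "x \<in> {0..L}" "y \<in> {0..L}" "x < y" "\<phi> (c x) = \<phi> (c y)"
    then show "x = 0 \<and> y = L" using c_simple[OF assms(2)] inv(1) by metis
  qed (use L_pos c_closes der c_deriv c'_deriv norm norm_c' norm_c''[OF assms(3)] in auto)
  have tr: "trace = \<phi> ` \<gamma> ` {a..b}"
    using c_image by (metis image_image)
  obtain p where p: "cball p 1 \<subseteq> inside trace \<union> trace"
    using unit_disc_inside by blast
  have "cball (\<psi> p) 1 \<subseteq> bounded_region a b \<gamma>"
  proof
    fix x assume x: "x \<in> cball (\<psi> p) 1"
    have "dist p (\<phi> x) = norm (\<phi> (\<psi> p - x))" using lin(1) inv by (simp add: dist_norm linear_diff)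
    then have "\<phi> x \<in> cball p 1" using x norm by (simp add: dist_norm)
    then consider "\<phi> x \<in> inside (\<phi> ` \<gamma> ` {a..b})" | "\<phi> x \<in> \<phi> ` \<gamma> ` {a..b}" using p tr by auto
    then show "x \<in> bounded_region a b \<gamma>"
    proof cases
      case 1
      then have "\<psi> (\<phi> x) \<in> inside (\<gamma> ` {a..b})"
        by (rule inside_linear_image_subset[OF lin inv(2,1)])
      then show ?thesis using inv by (simp add: bounded_region_def)
    next
      case 2
      then show ?thesis using inv unfolding bounded_region_def by (metis UnI2 imageE)
    qed
  qed
  then show ?thesis by blast
qed

end
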